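(* The critical value based mechanism satisfies efficiency: for every $\theta'\in\Theta$, the set $g(\theta')$ of selected nodes satisfies $SW(g(\theta'))=\max_{S\subseteq V}SW(S)$.
   Context: **Cost sharing problem.** Let $V$ be a finite set of nodes, $s\notin V$ a source, and $G=\langle V\cup\{s\},E\rangle$ a connected undirected graph in which each edge $(i,j)\in E$ has a cost $c_{(i,j)}\ge 0$. Each $i\in V$ has a private valuation $v_i\ge 0$. For $i\in V\cup\{s\}$ let $e_i$ be the set of edges adjacent to $i$, and let $\theta_i=(e_i,v_i)$ be the type of $i$ (the valuation of $s$ is null). Each node makes a report $\theta_i'=(e_i',v_i')$ with $e_i'\subseteq e_i$ and $v_i'\ge 0$; the source does not behave strategically. Let $\theta'=(\theta_i')_{i\in V\cup\{s\}}$ be the report profile, and $\Theta$ the space of all profiles. The induced graph is $G(\theta')=\langle V\cup\{s\},E(\theta')\rangle$ with $E(\theta')=\{(i,j)\in E : (i,j)\in e_i'\cap e_j'\}$. **Mechanism.** A cost sharing mechanism $(g,f,x)$ consists of $g:\Theta\to 2^V$ (selected nodes), $f:\Theta\to 2^E$ with $f(\theta')\subseteq E(\theta')$ (selected edges connecting the selected nodes), and $x:\Theta\to\mathbb{R}^{|V|}$ (cost shares), with $x_i(\theta')=0$ if $i\notin g(\theta')$. **Social welfare and $\delta$.** For $S\subseteq V$, $C(S)$ is the weight of a minimum Steiner tree of $S\cup\{s\}$ in $G(\theta')$ (a minimum-weight tree containing these nodes, possibly using other nodes); $C(S)=+\infty$ if no such tree exists. $SW(S)=\sum_{i\in S}v_i'-C(S)$.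 Define $\delta(S)\subseteq S$ for $S\subseteq V$ in ascending order of cardinality: $\delta(\emptyset)=\emptyset$, $SW(\emptyset)=0$; for $S\ne\emptyset$, if $\sum_{i\in S}v_i'-C(S)\ge\max_{S'} SW(\delta(S'))$, where $S'$ ranges over subsets of $S$ with $|S'|=|S|-1$, then $\delta(S)=S$; otherwise $\delta(S)=\delta(S^* )$ for an $S^*$ attaining this maximum. **Critical value based mechanism (CVM).** Given $\theta'$: set $g(\theta')=\delta(V)$; let $f(\theta')$ be the edge set of a minimum Steiner tree of $g(\theta')\cup\{s\}$ in $G(\theta')$; for $i\in g(\theta')$ set $$x_i(\theta')=CV_i(\theta')=\Big(\sum_{j\in\delta(g(\theta')\setminus\{i\})}v_j'-C(\delta(g(\theta')\setminus\{i\}))\Big)-\Big(\sum_{k\in g(\theta')\setminus\{i\}}v_k'-C(g(\theta'))\Big),$$ and $x_i(\theta')=0$ for $i\notin g(\theta')$. *)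

theory Defs
  imports "HOL-Library.FuncSet" "HOL-Library.Extended_Real"
begin

text \<open>An undirected edge between \<open>i\<close> and \<open>j\<close> is the two-element set \<open>{i, j}\<close>.\<close>

definition simple_graph :: "'a set \<Rightarrow> 'a set set \<Rightarrow> bool" where
  "simple_graph W E \<longleftrightarrow> finite W \<and> E \<subseteq> {{i, j} | i j. i \<in> W \<and> j \<in> W \<and> i \<noteq> j}"

definition reachable :: "'a set set \<Rightarrow> 'a \<Rightarrow> 'a \<Rightarrow> bool" where
  "reachable E u v \<longleftrightarrow> (u, v) \<in> {(a, b). {a, b} \<in> E}\<^sup>*"

definition connected_graph :: "'a set \<Rightarrow> 'a set set \<Rightarrow> bool" where
  "connected_graph W E \<longleftrightarrow> simple_graph W E \<and> W \<noteq> {} \<and> (\<forall>u\<in>W. \<forall>v\<in>W. reachable E u v)"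

definition is_cycle :: "'a set set \<Rightarrow> 'a list \<Rightarrow> bool" where
  "is_cycle E p \<longleftrightarrow> 3 \<le> length p \<and> distinct p \<and>
     (\<forall>k<length p. {p ! k, p ! (Suc k mod length p)} \<in> E)"

definition is_tree :: "'a set \<Rightarrow> 'a set set \<Rightarrow> bool" where
  "is_tree W E \<longleftrightarrow> connected_graph W E \<and> \<not> (\<exists>p. is_cycle E p)"

record 'a cost_sharing =
  nodes :: "'a set"
  source :: 'a
  edges :: "'a set set"
  cost :: "'a set \<Rightarrow> real"
  valuation :: "'a \<Rightarrow> real"

text \<open>The null valuation of the source is encoded as \<open>0\<close>; it never enters a welfare sum.\<close>

definition cost_sharing_problem :: "'a cost_sharing \<Rightarrow> bool" where
  "cost_sharing_problem N \<longleftrightarrow>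
     finite (nodes N) \<and> source N \<notin> nodes N \<and>
     connected_graph (nodes N \<union> {source N}) (edges N) \<and>
     (\<forall>e\<in>edges N. 0 \<le> cost N e) \<and>
     (\<forall>i\<in>nodes N. 0 \<le> valuation N i) \<and> valuation N (source N) = 0"

type_synonym 'a node_type = "'a set set \<times> real"

abbreviation reported_edges :: "('a \<Rightarrow> 'a node_type) \<Rightarrow> 'a \<Rightarrow> 'a set set" where
  "reported_edges \<theta> i \<equiv> fst (\<theta> i)"

abbreviation reported_value :: "('a \<Rightarrow> 'a node_type) \<Rightarrow> 'a \<Rightarrow> real" where
  "reported_value \<theta> i \<equiv> snd (\<theta> i)"

definition incident :: "'a cost_sharing \<Rightarrow> 'a \<Rightarrow> 'a set set" where
  "incident N i = {e \<in> edges N. i \<in> e}"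

definition true_type :: "'a cost_sharing \<Rightarrow> 'a \<Rightarrow> 'a node_type" where
  "true_type N i = (incident N i, valuation N i)"

text \<open>The source does not behave strategically, so it can only report its true type.\<close>

definition reports :: "'a cost_sharing \<Rightarrow> 'a \<Rightarrow> 'a node_type set" where
  "reports N i =
     (if i = source N then {true_type N i} else {(e, v). e \<subseteq> incident N i \<and> 0 \<le> v})"

definition profiles :: "'a cost_sharing \<Rightarrow> ('a \<Rightarrow> 'a node_type) set" where
  "profiles N = (\<Pi>\<^sub>E i\<in>nodes N \<union> {source N}. reports N i)"

definition induced_edges :: "'a cost_sharing \<Rightarrow> ('a \<Rightarrow> 'a node_type) \<Rightarrow> 'a set set" where
  "induced_edges N \<theta> =
     {{i, j} | i j. {i, j} \<in> edges N \<and> {i, j} \<in> reported_edges \<theta> i \<inter> reported_edges \<theta> j}"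

text \<open>The node set is part of a tree, so that the one-node tree without edges is covered.\<close>

definition steiner_trees ::
  "'a cost_sharing \<Rightarrow> ('a \<Rightarrow> 'a node_type) \<Rightarrow> 'a set \<Rightarrow> ('a set \<times> 'a set set) set" where
  "steiner_trees N \<theta> S =
     {(W, T). W \<subseteq> nodes N \<union> {source N} \<and> T \<subseteq> induced_edges N \<theta> \<and>
              is_tree W T \<and> S \<union> {source N} \<subseteq> W}"

definition weight :: "'a cost_sharing \<Rightarrow> 'a set \<times> 'a set set \<Rightarrow> real" where
  "weight N t = (\<Sum>e\<in>snd t. cost N e)"

definition min_steiner_tree ::
  "'a cost_sharing \<Rightarrow> ('a \<Rightarrow> 'a node_type) \<Rightarrow> 'a set \<Rightarrow> 'a set \<times> 'a set set \<Rightarrow> bool" where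
  "min_steiner_tree N \<theta> S t \<longleftrightarrow>
     t \<in> steiner_trees N \<theta> S \<and> (\<forall>t'\<in>steiner_trees N \<theta> S. weight N t \<le> weight N t')"

definition steiner_cost ::
  "'a cost_sharing \<Rightarrow> ('a \<Rightarrow> 'a node_type) \<Rightarrow> 'a set \<Rightarrow> ereal" where
  "steiner_cost N \<theta> S =
     (if steiner_trees N \<theta> S = {} then \<infinity>
      else ereal (Min (weight N ` steiner_trees N \<theta> S)))"

definition SW :: "'a cost_sharing \<Rightarrow> ('a \<Rightarrow> 'a node_type) \<Rightarrow> 'a set \<Rightarrow> ereal" where
  "SW N \<theta> S = ereal (\<Sum>i\<in>S. reported_value \<theta> i) - steiner_cost N \<theta> S"

definition maximal_subsets :: "'a set \<Rightarrow> 'a set set" where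
  "maximal_subsets S = {S'. S' \<subseteq> S \<and> card S' = card S - 1}"

text \<open>
  The recursion for \<open>\<delta>\<close> leaves open which maximiser \<open>S*\<close> is taken; the predicate holds for the
  functions arising from every possible way of breaking ties.
\<close>

definition is_delta ::
  "'a cost_sharing \<Rightarrow> ('a \<Rightarrow> 'a node_type) \<Rightarrow> ('a set \<Rightarrow> 'a set) \<Rightarrow> bool" where
  "is_delta N \<theta> \<delta> \<longleftrightarrow>
     \<delta> {} = {} \<and>
     (\<forall>S. S \<subseteq> nodes N \<and> S \<noteq> {} \<longrightarrow>
        (let m = Max ((\<lambda>S'. SW N \<theta> (\<delta> S')) ` maximal_subsets S) in
         if SW N \<theta> S \<ge> m then \<delta> S = S
         else (\<exists>S'\<in>maximal_subsets S. SW N \<theta> (\<delta> S') = m \<and> \<delta> S = \<delta> S')))"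

definition critical_value ::
  "'a cost_sharing \<Rightarrow> ('a \<Rightarrow> 'a node_type) \<Rightarrow> ('a set \<Rightarrow> 'a set) \<Rightarrow> 'a set \<Rightarrow> 'a \<Rightarrow> ereal" where
  "critical_value N \<theta> \<delta> A i =
     (ereal (\<Sum>j\<in>\<delta> (A - {i}). reported_value \<theta> j) - steiner_cost N \<theta> (\<delta> (A - {i}))) -
     (ereal (\<Sum>k\<in>A - {i}. reported_value \<theta> k) - steiner_cost N \<theta> A)"

text \<open>
  The mechanism is a triple of selection \<open>g\<close>, edge set \<open>f\<close> and cost shares \<open>x\<close>, constrained on
  report profiles only. Ties among maximisers and among minimum Steiner trees may be broken
  differently at each profile. The shares are real numbers: both differences in
  \<open>critical_value\<close> are finite for selected nodes, since every value of \<open>\<delta>\<close> has welfare at least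
  \<open>SW({}) = 0\<close>.
\<close>

definition critical_value_mechanism ::
  "'a cost_sharing \<Rightarrow> (('a \<Rightarrow> 'a node_type) \<Rightarrow> 'a set) \<Rightarrow>
   (('a \<Rightarrow> 'a node_type) \<Rightarrow> 'a set set) \<Rightarrow> (('a \<Rightarrow> 'a node_type) \<Rightarrow> 'a \<Rightarrow> real) \<Rightarrow> bool" where
  "critical_value_mechanism N g f x \<longleftrightarrow>
     (\<forall>\<theta>\<in>profiles N. \<exists>\<delta>. is_delta N \<theta> \<delta> \<and>
        g \<theta> = \<delta> (nodes N) \<and>
        (\<exists>W. min_steiner_tree N \<theta> (g \<theta>) (W, f \<theta>)) \<and>
        (\<forall>i\<in>g \<theta>. ereal (x \<theta> i) = critical_value N \<theta> \<delta> (g \<theta>) i) \<and>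
        (\<forall>i\<in>nodes N - g \<theta>. x \<theta> i = 0))"

definition efficient ::
  "'a cost_sharing \<Rightarrow> (('a \<Rightarrow> 'a node_type) \<Rightarrow> 'a set) \<Rightarrow> bool" where
  "efficient N g \<longleftrightarrow>
     (\<forall>\<theta>\<in>profiles N. SW N \<theta> (g \<theta>) = Max (SW N \<theta> ` Pow (nodes N)))"

end

theory Submission
  imports Defs
begin

text \<open>By strong induction on the finite set \<open>S\<close>, \<open>\<delta> S\<close>
  attains the largest welfare among all subsets of \<open>S\<close>; efficiency is the case of all
  nodes. A proper subset \<open>T\<close> misses some node \<open>a\<close>, so it lies in
  \<open>S - {a}\<close>, whose \<open>\<delta>\<close> is at least as good as \<open>T\<close> by
  induction. The recursion makes \<open>\<delta> S\<close> at least as good as \<open>S\<close>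
  itself and as every such candidate, however ties are broken. The induction is
  \<open>delta_optimal\<close>.\<close>

lemma proper_subset_of_maximal_subset:
  assumes "finite S" and "T \<subset> S"
  obtains S' where "S' \<in> maximal_subsets S" and "T \<subseteq> S'"
proof -
  from assms(2) obtain a where a: "a \<in> S" "a \<notin> T" by blast
  show ?thesis
  proof
    show "S - {a} \<in> maximal_subsets S"
      using assms(1) a(1) by (auto simp: maximal_subsets_def)
    show "T \<subseteq> S - {a}"
      using assms(2) a(2) by blast
  qed
qed

lemma finite_maximal_subsets: "finite S \<Longrightarrow> finite (maximal_subsets S)"
  by (rule finite_subset[of _ "Pow S"]) (auto simp: maximal_subsets_def)

text \<open>The inclusion accompanies the bound so that the upper bound is also attained:
  \<open>\<delta> S\<close> is itself one of the competing subsets.\<close>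

lemma delta_optimal:
  assumes fin: "finite (nodes N)" and delta: "is_delta N \<theta> \<delta>" and "S \<subseteq> nodes N"
  shows "\<delta> S \<subseteq> S \<and> (\<forall>T\<subseteq>S. SW N \<theta> T \<le> SW N \<theta> (\<delta> S))"
  using finite_subset[OF assms(3) fin] assms(3)
proof (induction S rule: finite_psubset_induct)
  case (psubset S)
  show ?case
  proof (cases "S = {}")
    case True
    then show ?thesis using delta by (simp add: is_delta_def)
  next
    case False
    define M where "M = (\<lambda>S'. SW N \<theta> (\<delta> S')) ` maximal_subsets S"
    have step: "if Max M \<le> SW N \<theta> S then \<delta> S = S
        else \<exists>S'\<in>maximal_subsets S. SW N \<theta> (\<delta> S') = Max M \<and> \<delta> S = \<delta> S'"
      using delta False psubset.prems by (simp add: is_delta_def M_def Let_def)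
    have IH: "\<delta> S' \<subseteq> S' \<and> (\<forall>T\<subseteq>S'. SW N \<theta> T \<le> SW N \<theta> (\<delta> S'))" and sub: "S' \<subseteq> S"
      if "S' \<in> maximal_subsets S" for S'
    proof -
      \<comment> \<open>Positivity keeps the natural-number subtraction in \<open>card S - 1\<close>
        from truncating, so members of \<open>maximal_subsets S\<close> are strictly smaller than
        \<open>S\<close> and the induction hypothesis applies.\<close>
      have "card S > 0" using False psubset.hyps by (simp add: card_gt_0_iff)
      then have "S' \<subset> S" using that by (auto simp: maximal_subsets_def)
      then show "\<delta> S' \<subseteq> S' \<and> (\<forall>T\<subseteq>S'. SW N \<theta> T \<le> SW N \<theta> (\<delta> S'))" and "S' \<subseteq> S"
        using psubset.IH psubset.prems by blast+
    qed
    have contained: "\<delta> S \<subseteq> S"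
      using step IH sub by (metis order.trans order.refl)
    \<comment> \<open>If \<open>\<delta> S = S\<close>, the second bound is the test of the
      recursion; otherwise \<open>\<delta> S\<close> has welfare \<open>Max M\<close>, and the
      failed test gives the first.\<close>
    have full: "SW N \<theta> S \<le> SW N \<theta> (\<delta> S)" and max: "Max M \<le> SW N \<theta> (\<delta> S)"
      using step by (auto split: if_splits)
    have "SW N \<theta> T \<le> SW N \<theta> (\<delta> S)" if "T \<subseteq> S" for T
    proof (cases "T = S")
      case True
      then show ?thesis using full by simp
    next
      case False
      with that obtain S' where S': "S' \<in> maximal_subsets S" "T \<subseteq> S'"
        using proper_subset_of_maximal_subset[OF psubset.hyps] by blast
      then have "SW N \<theta> T \<le> SW N \<theta> (\<delta> S')"
        using IH by blast
      also have "\<dots> \<le> Max M"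
        using S'(1) finite_maximal_subsets[OF psubset.hyps] by (simp add: M_def)
      finally show ?thesis using max by (rule order.trans)
    qed
    with contained show ?thesis by blast
  qed
qed

theorem theorem5p5:
  fixes N :: "'a cost_sharing"
    and g :: "('a \<Rightarrow> 'a node_type) \<Rightarrow> 'a set"
    and f :: "('a \<Rightarrow> 'a node_type) \<Rightarrow> 'a set set"
    and x :: "('a \<Rightarrow> 'a node_type) \<Rightarrow> 'a \<Rightarrow> real"
  assumes "cost_sharing_problem N"
    and "critical_value_mechanism N g f x"
  shows "efficient N g"
  unfolding efficient_def
proof
  fix \<theta> assume "\<theta> \<in> profiles N"
  then obtain \<delta> where "is_delta N \<theta> \<delta>" and g: "g \<theta> = \<delta> (nodes N)"
    using assms(2) by (auto simp: critical_value_mechanism_def)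
  moreover have fin: "finite (nodes N)"
    using assms(1) by (simp add: cost_sharing_problem_def)
  ultimately have "g \<theta> \<subseteq> nodes N" "\<forall>T\<subseteq>nodes N. SW N \<theta> T \<le> SW N \<theta> (g \<theta>)"
    using delta_optimal[of N \<theta> \<delta> "nodes N"] by auto
  \<comment> \<open>The inclusion \<open>g \<theta> \<subseteq> nodes N\<close> puts this welfare
    among the values being maximised, so the upper bound is the maximum.\<close>
  then show "SW N \<theta> (g \<theta>) = Max (SW N \<theta> ` Pow (nodes N))"
    using fin by (intro Max_eqI[symmetric]) auto
qed

end
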